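(* Let $M$ be a real $5$-dimensional manifold endowed with a Lorentzian metric $g$ of signature $(-++++)$. Let $T_{ab}$ be a real second order symmetric tensor at a point $p\in M$, and let $T^a{}_b=g^{ac}T_{cb}$ be its mixed form, regarded as a linear operator $T_p(M)\to T_p(M)$. Then: 1. $T^a{}_b$ has a timelike eigenvector if and only if it is diagonable over $\mathbb{R}$ at $p$. 2. $T^a{}_b$ has at least three real, mutually orthogonal, linearly independent eigenvectors at $p$, at least two of which are spacelike. 3. $T^a{}_b$ has all its eigenvalues real at $p$ and is not diagonable if and only if it has a unique null eigendirection at $p$. 4. If $T^a{}_b$ has two linearly independent null eigenvectors at $p$, then it is diagonable over $\mathbb{R}$ at $p$ and the eigenvalues corresponding to these null eigenvectors are real.
   Context: The eigenvalue problem is $T^a{}_b V^b=\lambda V^a$ with $V\neq 0$; although $T^a{}_b$ is a real matrix, its eigenvalues (roots of the characteristic equation $\det(T-\lambda I)=0$) and eigenvectors may be complex. "Diagonable over $\mathbb{R}$" means diagonalizable by a real similarity transformation. A nonzero real vector $v\in T_p(M)$ is timelike, null or spacelike according as $g(v,v)<0$, $=0$ or $>0$; timelike, null and spacelike eigenvectors are understood to be real vectors of $T_p(M)$. A null eigendirection is a one-dimensional subspace of $T_p(M)$ spanned by a null eigenvector. Orthogonality is with respect to $g$. *)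

theory Defs
  imports "HOL-Analysis.Analysis"
begin

text \<open>
  The type \<open>'v\<close> is the tangent space \<open>T\<^sub>p(M)\<close> of a manifold at a point; the metric and the
  tensor at that point are symmetric bilinear forms on \<open>'v\<close>. Index notation refers to a frame
  \<open>e\<close>, an ordered basis indexed by the finite type \<open>'n\<close>, so that \<open>CARD('n)\<close> is the dimension.
\<close>

definition frame :: "('n::finite \<Rightarrow> 'v::real_vector) \<Rightarrow> bool" where
  "frame e \<longleftrightarrow> inj e \<and> independent (range e) \<and> span (range e) = UNIV"

definition components :: "('n::finite \<Rightarrow> 'v::real_vector) \<Rightarrow> 'v \<Rightarrow> real^'n" where
  "components e v = (\<chi> a. representation (range e) v (e a))"

definition symmetric_form :: "('v::real_vector \<Rightarrow> 'v \<Rightarrow> real) \<Rightarrow> bool" where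
  "symmetric_form h \<longleftrightarrow> bilinear h \<and> (\<forall>x y. h x y = h y x)"

text \<open>
  The index type of the orthonormal frame does not occur in the type of \<open>g\<close>, so it is passed as
  an explicit type argument. For \<open>'n = 5\<close> the signature is \<open>(-++++)\<close>.
\<close>

definition lorentzian :: "'n::finite itself \<Rightarrow> ('v::real_vector \<Rightarrow> 'v \<Rightarrow> real) \<Rightarrow> bool" where
  "lorentzian _ g \<longleftrightarrow> symmetric_form g \<and>
     (\<exists>(E :: 'n \<Rightarrow> 'v) t. frame E \<and>
        (\<forall>a b. g (E a) (E b) = (if a \<noteq> b then 0 else if a = t then -1 else 1)))"

definition timelike :: "('v::real_vector \<Rightarrow> 'v \<Rightarrow> real) \<Rightarrow> 'v \<Rightarrow> bool" where
  "timelike g v \<longleftrightarrow> v \<noteq> 0 \<and> g v v < 0"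

definition null :: "('v::real_vector \<Rightarrow> 'v \<Rightarrow> real) \<Rightarrow> 'v \<Rightarrow> bool" where
  "null g v \<longleftrightarrow> v \<noteq> 0 \<and> g v v = 0"

definition spacelike :: "('v::real_vector \<Rightarrow> 'v \<Rightarrow> real) \<Rightarrow> 'v \<Rightarrow> bool" where
  "spacelike g v \<longleftrightarrow> v \<noteq> 0 \<and> g v v > 0"

definition orthogonal_wrt :: "('v::real_vector \<Rightarrow> 'v \<Rightarrow> real) \<Rightarrow> 'v \<Rightarrow> 'v \<Rightarrow> bool" where
  "orthogonal_wrt g u v \<longleftrightarrow> g u v = 0"

text \<open>The covariant components \<open>h\<^sub>a\<^sub>b\<close>, and the mixed components \<open>T\<^sup>a\<^sub>b = g\<^sup>a\<^sup>c T\<^sub>c\<^sub>b\<close>,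
  where \<open>g\<^sup>a\<^sup>c\<close> is the inverse matrix of \<open>g\<^sub>a\<^sub>c\<close>.\<close>

definition lower_components ::
    "('n::finite \<Rightarrow> 'v::real_vector) \<Rightarrow> ('v \<Rightarrow> 'v \<Rightarrow> real) \<Rightarrow> real^'n^'n" where
  "lower_components e h = (\<chi> a b. h (e a) (e b))"

definition mixed_components ::
    "('n::finite \<Rightarrow> 'v::real_vector) \<Rightarrow> ('v \<Rightarrow> 'v \<Rightarrow> real) \<Rightarrow> ('v \<Rightarrow> 'v \<Rightarrow> real) \<Rightarrow> real^'n^'n" where
  "mixed_components e g T = matrix_inv (lower_components e g) ** lower_components e T"

text \<open>Eigenvalues and eigenvectors of a real matrix are taken over the complex numbers.\<close>

definition complex_matrix :: "real^'n^'n \<Rightarrow> complex^'n^'n" where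
  "complex_matrix A = map_matrix complex_of_real A"

definition complex_vector :: "real^'n \<Rightarrow> complex^'n" where
  "complex_vector x = (\<chi> a. complex_of_real (x $ a))"

definition eigenvalue :: "real^'n^'n \<Rightarrow> complex \<Rightarrow> bool" where
  "eigenvalue A l \<longleftrightarrow> det (complex_matrix A - mat l) = 0"

definition eigenvector :: "real^'n^'n \<Rightarrow> complex \<Rightarrow> complex^'n \<Rightarrow> bool" where
  "eigenvector A l z \<longleftrightarrow> z \<noteq> 0 \<and> complex_matrix A *v z = l *s z"

text \<open>A tangent vector is real, but the eigenvalue it belongs to is not assumed to be.\<close>

definition tangent_eigenvector ::
    "('n::finite \<Rightarrow> 'v::real_vector) \<Rightarrow> real^'n^'n \<Rightarrow> complex \<Rightarrow> 'v \<Rightarrow> bool" where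
  "tangent_eigenvector e A l v \<longleftrightarrow> eigenvector A l (complex_vector (components e v))"

definition diagonable_real :: "real^'n^'n \<Rightarrow> bool" where
  "diagonable_real A \<longleftrightarrow>
     (\<exists>P :: real^'n^'n. invertible P \<and>
        (\<forall>i j. i \<noteq> j \<longrightarrow> (matrix_inv P ** A ** P) $ i $ j = 0))"

definition null_eigendirection ::
    "('n::finite \<Rightarrow> 'v::real_vector) \<Rightarrow> ('v \<Rightarrow> 'v \<Rightarrow> real) \<Rightarrow> real^'n^'n \<Rightarrow> 'v set \<Rightarrow> bool" where
  "null_eigendirection e g A D \<longleftrightarrow>
     (\<exists>v l. null g v \<and> tangent_eigenvector e A l v \<and> D = span {v})"

end

theory Submission
  imports Defs "HOL-Computational_Algebra.Fundamental_Theorem_Algebra"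
begin

text \<open>
  In the coordinates of the frame, \<open>A\<close> is self-adjoint for a Lorentzian form \<open>g\<close>. A nonzero
  invariant subspace contains either a real eigenvector or the real and imaginary parts \<open>x\<close>, \<open>y\<close>
  of an eigenvector for a nonreal eigenvalue. In the second case \<open>g x x + g y y = 0\<close>, so \<open>x\<close> and
  \<open>y\<close> span a Lorentzian plane and the form is positive definite on its orthogonal complement; in
  particular no such pair occurs in a positive definite subspace. Splitting off eigenvectors
  orthogonally reduces every claim to these facts and to the case of a null eigenvector \<open>k\<close>, where
  \<open>(A - r)\<^sup>2\<close> maps the orthogonal complement of \<open>k\<close> onto a positive definite subspace; if that
  subspace is zero, \<open>A - r\<close> maps the complement into the line of \<open>k\<close> and so has a large kernel.
\<close>

section \<open>Eigenvectors and complex pairs in invariant subspaces\<close>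

text \<open>The vector \<open>p(L) v\<close>, computed by Horner's scheme. The general type lets the
  same construction serve for \<open>L\<close> and for multiplication by a complex number
  \<open>z\<close>, where its value at \<open>1\<close> is \<open>p(z)\<close>.\<close>

definition poly_map :: "('a::real_vector \<Rightarrow> 'a) \<Rightarrow> real poly \<Rightarrow> 'a \<Rightarrow> 'a" where
  "poly_map L p v = fold_coeffs (\<lambda>a w. a *\<^sub>R v + L w) p 0"

lemma degree_le_one_cases:
  assumes "degree p \<le> 1"
  obtains c d where "p = [:c, d:]"
proof -
  obtain c q where p: "p = pCons c q" by (cases p)
  with assms have "degree q = 0" by (auto split: if_splits)
  with p that show ?thesis by (metis degree_eq_zeroE)
qed

context
  fixes L :: "'a::real_vector \<Rightarrow> 'a"
  assumes L: "linear L"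
begin

lemma poly_map_0 [simp]: "poly_map L 0 v = 0"
  by (simp add: poly_map_def)

lemma poly_map_pCons [simp]: "poly_map L (pCons a p) v = a *\<^sub>R v + L (poly_map L p v)"
  using L by (cases "a = 0 \<and> p = 0") (auto simp: poly_map_def linear_0)

lemma poly_map_add: "poly_map L (p + q) v = poly_map L p v + poly_map L q v"
  by (induction p q rule: poly_induct2) (simp_all add: linear_add[OF L] scaleR_left_distrib)

lemma poly_map_smult: "poly_map L (smult c p) v = c *\<^sub>R poly_map L p v"
  by (induction p) (simp_all add: linear_cmul[OF L] scaleR_right_distrib)

lemma poly_map_mult: "poly_map L (p * q) v = poly_map L p (poly_map L q v)"
  by (induction p) (simp_all add: poly_map_add poly_map_smult)

lemma poly_map_monom: "poly_map L (monom c n) v = c *\<^sub>R (L ^^ n) v"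
  by (induction n) (simp_all add: monom_0 monom_Suc linear_0[OF L] linear_cmul[OF L])

lemma poly_map_in:
  assumes "subspace W" "\<And>x. x \<in> W \<Longrightarrow> L x \<in> W" "v \<in> W"
  shows "poly_map L p v \<in> W"
  using assms by (induction p) (auto intro: subspace_add subspace_scale subspace_0)

end

text \<open>A complex root \<open>z\<close> of \<open>p\<close> has a real linear or quadratic
  polynomial \<open>r\<close> dividing \<open>p = r * q\<close>. If \<open>q(L) v\<close> vanishes,
  induction applies to \<open>q\<close>; otherwise \<open>w = q(L) v\<close> is a nonzero vector
  killed by \<open>r(L)\<close>, and the two shapes of \<open>r\<close> give the two
  alternatives.\<close>

lemma eigenvector_or_pair_of_poly_map:
  fixes L :: "'a::real_vector \<Rightarrow> 'a"
  assumes L: "linear L" and W: "subspace W" "\<And>x. x \<in> W \<Longrightarrow> L x \<in> W" and v: "v \<in> W" "v \<noteq> 0"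
    and p: "p \<noteq> 0" "poly_map L p v = 0"
  shows "(\<exists>x\<in>W. \<exists>r. x \<noteq> 0 \<and> L x = r *\<^sub>R x) \<or>
    (\<exists>x\<in>W. \<exists>y\<in>W. \<exists>a b. x \<noteq> 0 \<and> b \<noteq> 0 \<and>
      L x = a *\<^sub>R x - b *\<^sub>R y \<and> L y = b *\<^sub>R x + a *\<^sub>R y)"
  using p
proof (induction "degree p" arbitrary: p rule: less_induct)
  case less
  have "degree p \<noteq> 0"
  proof
    assume "degree p = 0"
    then obtain c where "p = [:c:]" by (metis degree_eq_zeroE)
    with less.prems v show False by (simp add: linear_0[OF L] poly_map_0[OF L] poly_map_pCons[OF L])
  qed
  then have "\<not> constant (poly (map_poly complex_of_real p))"
    by (simp add: constant_degree degree_map_poly)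
  then obtain z where "poly (map_poly complex_of_real p) z = 0"
    using fundamental_theorem_of_algebra by blast
  moreover have M: "linear ((*) z)" by (simp add: linear_times)
  moreover have "poly (map_poly complex_of_real f) z = poly_map ((*) z) f 1" for f
    by (induction f) (simp_all add: poly_map_0[OF M] poly_map_pCons[OF M] map_poly_pCons scaleR_conv_of_real)
  ultimately have z: "poly_map ((*) z) p 1 = 0" by simp
  note M_simps = poly_map_0[OF M] poly_map_pCons[OF M] poly_map_add[OF M] poly_map_mult[OF M]
  obtain r where r: "r dvd p" "degree r \<noteq> 0" and
    r': "r = [:- Re z, 1:] \<or> (Im z \<noteq> 0 \<and> r = [:(Re z)\<^sup>2 + (Im z)\<^sup>2, - 2 * Re z, 1:])"
  proof (cases "Im z = 0")
    case True
    then have "z = complex_of_real (Re z)" by (simp add: complex_eq_iff)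
    then have "poly_map ((*) z) f 1 = complex_of_real (poly f (Re z))" for f
      by (induction f) (simp_all add: M_simps scaleR_conv_of_real)
    with z have "[:- Re z, 1:] dvd p" by (simp add: poly_eq_0_iff_dvd)
    then show ?thesis using that by simp
  next
    case False
    \<comment> \<open>This is the product of \<open>X - z\<close> and \<open>X - cnj z\<close>.
      Division by it leaves a real remainder \<open>c + d X\<close> that vanishes at the nonreal
      \<open>z\<close>, so both coefficients are zero.\<close>
    define r where "r = [:(Re z)\<^sup>2 + (Im z)\<^sup>2, - 2 * Re z, 1:]"
    have dr: "degree r = 2" "r \<noteq> 0" by (simp_all add: r_def)
    have rz: "poly_map ((*) z) r 1 = 0"
      by (simp add: r_def M_simps complex_eq_iff power2_eq_square algebra_simps)
    define m where "m = p mod r"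
    have "degree m < 2 \<or> m = 0"
      using degree_mod_less[of r p] dr by (auto simp: m_def)
    then have "degree m \<le> 1" by auto
    then obtain c d where m: "m = [:c, d:]"
      by (metis degree_le_one_cases)
    have "poly_map ((*) z) (p div r) 0 = 0" using poly_map_in[OF M subspace_single_0, of 0 "p div r"] by simp
    then have "poly_map ((*) z) ((p div r) * r + m) 1 = poly_map ((*) z) m 1"
      using rz by (simp only: M_simps add_0)
    then have "poly_map ((*) z) m 1 = 0" using z by (simp add: m_def)
    then have "c = 0 \<and> d = 0"
      using False by (auto simp: m M_simps complex_eq_iff)
    then have "r dvd p" using m by (simp add: m_def dvd_eq_mod_eq_0)
    then show ?thesis using that dr False by (simp add: r_def)
  qed
  obtain q where q: "p = r * q" using r by blast
  have q0: "q \<noteq> 0" "r \<noteq> 0" using q less.prems by auto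
  then have dq: "degree q < degree p" using r q by (simp add: degree_mult_eq)
  define w where "w = poly_map L q v"
  have wW: "w \<in> W" unfolding w_def by (intro poly_map_in L W v)
  show ?case
  proof (cases "w = 0")
    case True
    with less.hyps[OF dq q0(1)] show ?thesis by (simp add: w_def)
  next
    case False
    have rw: "poly_map L r w = 0"
      using less.prems by (simp add: q poly_map_mult[OF L] w_def)
    from r' show ?thesis
    proof
      assume "r = [:- Re z, 1:]"
      with rw have "L w = Re z *\<^sub>R w" by (simp add: linear_0[OF L] poly_map_0[OF L] poly_map_pCons[OF L])
      then show ?thesis using False wW by blast
    next
      assume "Im z \<noteq> 0 \<and> r = [:(Re z)\<^sup>2 + (Im z)\<^sup>2, - 2 * Re z, 1:]"
      then obtain a b where b: "b \<noteq> 0" and r2: "r = [:a\<^sup>2 + b\<^sup>2, - 2 * a, 1:]" by blast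
      \<comment> \<open>Solves \<open>L w = a w - b y\<close> for \<open>y\<close>. The quadratic
        relation for \<open>w\<close> then yields \<open>L y\<close>, so that \<open>w + i y\<close>
        is an eigenvector for \<open>a + i b\<close>.\<close>
      define y where "y = (1 / b) *\<^sub>R (a *\<^sub>R w - L w)"
      have by': "b *\<^sub>R y = a *\<^sub>R w - L w" using b by (simp add: y_def)
      have yW: "y \<in> W" unfolding y_def by (intro subspace_scale subspace_diff W wW)
      have e1: "L w = a *\<^sub>R w - b *\<^sub>R y" using by' by simp
      have "L (L w) = (2 * a) *\<^sub>R L w - (a\<^sup>2 + b\<^sup>2) *\<^sub>R w"
        using rw by (simp add: r2 poly_map_0[OF L] poly_map_pCons[OF L] linear_0[OF L] linear_add[OF L] linear_cmul[OF L] linear_diff[OF L] linear_neg[OF L] eq_diff_eq add_eq_0_iff algebra_simps)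
      then have "b *\<^sub>R L y = a *\<^sub>R L w - ((2 * a) *\<^sub>R L w - (a\<^sup>2 + b\<^sup>2) *\<^sub>R w)"
        by (metis by' linear_cmul[OF L] linear_diff[OF L])
      also have "\<dots> = (a\<^sup>2 + b\<^sup>2) *\<^sub>R w - a *\<^sub>R (a *\<^sub>R w - b *\<^sub>R y)"
        by (simp only: e1 mult_2 scaleR_add_left) (simp add: algebra_simps)
      also have "\<dots> = b *\<^sub>R (b *\<^sub>R w + a *\<^sub>R y)"
        by (simp add: algebra_simps power2_eq_square)
      finally have "L y = b *\<^sub>R w + a *\<^sub>R y" using b by simp
      with e1 b False wW yW show ?thesis by blast
    qed
  qed
qed

section \<open>Annihilating polynomials in finite dimension\<close>

text \<open>Indexing the coefficients by \<open>i\<close> instead of by vectors keeps the formula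
  correct when \<open>f\<close> repeats a value.\<close>

lemma span_image_lessThan:
  fixes f :: "nat \<Rightarrow> 'a::real_vector"
  assumes "x \<in> span (f ` {..<d})"
  shows "\<exists>c. x = (\<Sum>i<d. c i *\<^sub>R f i)"
  using assms
proof (induction d arbitrary: x)
  case (Suc d)
  then obtain k where "x - k *\<^sub>R f d \<in> span (f ` {..<d})"
    by (auto simp: lessThan_Suc span_insert)
  from Suc.IH[OF this] obtain c where "x - k *\<^sub>R f d = (\<Sum>i<d. c i *\<^sub>R f i)" ..
  then have "x = (\<Sum>i<Suc d. (c(d := k)) i *\<^sub>R f i)" by (simp add: algebra_simps)
  then show ?case by blast
qed auto

text \<open>The iterates of \<open>v\<close> under \<open>L\<close> cannot all be independent of
  their predecessors, because the dimension is finite. A dependence of the \<open>d\<close>-th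
  iterate on the earlier ones is a monic polynomial of degree \<open>d\<close> killing
  \<open>v\<close>.\<close>

lemma exists_annihilating_poly:
  fixes L :: "'a::euclidean_space \<Rightarrow> 'a"
  assumes L: "linear L"
  obtains p where "p \<noteq> 0" "poly_map L p v = 0"
proof -
  define f where "f i = (L ^^ i) v" for i
  have "\<exists>d. f d \<in> span (f ` {..<d})"
  proof (rule ccontr)
    assume "\<not> ?thesis"
    then have n: "f d \<notin> span (f ` {..<d})" for d by blast
    have "independent (f ` {..<d}) \<and> card (f ` {..<d}) = d" for d
    proof (induction d)
      case (Suc d)
      have "f d \<notin> f ` {..<d}" by (metis n span_base)
      with Suc n[of d] show ?case
        by (simp add: lessThan_Suc independent_insert)
    qed (simp add: independent_empty)
    from this[of "Suc DIM('a)"] show False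
      using independent_bound[of "f ` {..<Suc DIM('a)}"] by linarith
  qed
  then obtain d where "f d \<in> span (f ` {..<d})" ..
  from span_image_lessThan[OF this] obtain c where c: "f d = (\<Sum>i<d. c i *\<^sub>R f i)" ..
  define q where "q = (\<Sum>i<d. monom (- c i) i)"
  have "poly_map L (\<Sum>i<n. monom (- c i) i) v = - (\<Sum>i<n. c i *\<^sub>R f i)" for n
    by (induction n) (simp_all add: poly_map_0[OF L] poly_map_add[OF L] poly_map_monom[OF L] f_def)
  then have "poly_map L (monom 1 d + q) v = 0"
    by (simp add: q_def poly_map_add[OF L] poly_map_monom[OF L] c[symmetric]) (simp add: f_def)
  moreover have "coeff (monom 1 d + q) d = 1" by (simp add: q_def coeff_sum)
  then have "monom 1 d + q \<noteq> 0" by (metis coeff_0 zero_neq_one)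
  ultimately show ?thesis using that by blast
qed

lemma invariant_subspace_cases:
  fixes L :: "'a::euclidean_space \<Rightarrow> 'a"
  assumes L: "linear L" and W: "subspace W" "\<And>x. x \<in> W \<Longrightarrow> L x \<in> W" and v: "v \<in> W" "v \<noteq> 0"
  obtains (eigen) x r where "x \<in> W" "x \<noteq> 0" "L x = r *\<^sub>R x"
  | (pair) x y a b where "x \<in> W" "y \<in> W" "x \<noteq> 0" "b \<noteq> 0"
      "L x = a *\<^sub>R x - b *\<^sub>R y" "L y = b *\<^sub>R x + a *\<^sub>R y"
proof -
  obtain p where "p \<noteq> 0" "poly_map L p v = 0" by (rule exists_annihilating_poly[OF L])
  from eigenvector_or_pair_of_poly_map[OF L W v this] show ?thesis
    using eigen pair by blast
qed

section \<open>Self-adjoint maps of a Lorentzian space\<close>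

text \<open>A single \<open>w\<close> in \<open>W\<close> with \<open>f w\<close> nonzero, if there
  is one, generates \<open>W\<close> together with the section.\<close>

lemma dim_hyperplane_section:
  fixes W :: "'a::euclidean_space set" and f :: "'a \<Rightarrow> real"
  assumes W: "subspace W" and f: "linear f"
  shows "subspace {x \<in> W. f x = 0}" "dim W \<le> Suc (dim {x \<in> W. f x = 0})"
proof -
  let ?H = "{x \<in> W. f x = 0}"
  show sub: "subspace ?H"
    using W by (auto simp: subspace_def linear_add[OF f] linear_cmul[OF f] linear_0[OF f])
  show "dim W \<le> Suc (dim ?H)"
  proof (cases "\<exists>w\<in>W. f w \<noteq> 0")
    case True
    then obtain w where w: "w \<in> W" "f w \<noteq> 0" by blast
    have "W \<subseteq> span (insert w ?H)"
    proof
      fix x assume x: "x \<in> W"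
      have "x - (f x / f w) *\<^sub>R w \<in> ?H"
        using x w W by (simp add: subspace_diff subspace_scale linear_diff[OF f] linear_cmul[OF f])
      then have "x - (f x / f w) *\<^sub>R w \<in> span ?H" by (rule span_base)
      then show "x \<in> span (insert w ?H)" unfolding span_insert by blast
    qed
    then have "dim W \<le> dim (insert w ?H)" by (metis dim_mono)
    also have "\<dots> \<le> Suc (dim ?H)" by (simp add: dim_insert)
    finally show ?thesis .
  next
    case False
    then have "?H = W" by auto
    then show ?thesis by simp
  qed
qed

lemma exists_nonzero_of_dim:
  fixes W :: "'a::euclidean_space set"
  assumes "dim W > 0"
  obtains x where "x \<in> W" "x \<noteq> 0"
proof -
  have "\<not> W \<subseteq> {0}" using assms by (metis dim_eq_0 less_irrefl)
  with that show ?thesis by blast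
qed

lemma dim_pos_of_nonzero:
  fixes W :: "'a::euclidean_space set"
  assumes "x \<in> W" "x \<noteq> 0"
  shows "dim W > 0"
  using assms by (metis dim_eq_0 gr0I singletonD subsetD)

text \<open>The signature \<open>(-+...+)\<close> is expressed by one timelike vector \<open>u0\<close> whose orthogonal complement
  is positive definite.\<close>

locale lorentz =
  fixes g :: "'a::euclidean_space \<Rightarrow> 'a \<Rightarrow> real" and u0 :: 'a
  assumes bil: "bilinear g" and sym: "g x y = g y x"
    and u0: "g u0 u0 < 0"
    and pos: "x \<noteq> 0 \<Longrightarrow> g x u0 = 0 \<Longrightarrow> g x x > 0"
begin

lemmas g_simps [simp] = bilinear_ladd[OF bil] bilinear_radd[OF bil] bilinear_lsub[OF bil]
  bilinear_rsub[OF bil] bilinear_lmul[OF bil] bilinear_rmul[OF bil]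
  bilinear_lzero[OF bil] bilinear_rzero[OF bil]

lemma linear_g: "linear (\<lambda>x. g x y)"
  using bil by (simp add: bilinear_def)

lemma orth_compl:
  assumes "subspace W"
  shows "subspace {x \<in> W. g x y = 0}" "dim W \<le> Suc (dim {x \<in> W. g x y = 0})"
  using dim_hyperplane_section[OF assms linear_g] .

text \<open>A combination \<open>w\<close> of \<open>x\<close> and \<open>y\<close> can be made
  orthogonal to \<open>u0\<close>. It is again nonspacelike, so positivity on the complement of
  \<open>u0\<close> forces \<open>w = 0\<close>.\<close>

lemma orth_nonspacelike:
  assumes "g x x \<le> 0" "g y y \<le> 0" "g x y = 0" "x \<noteq> 0" "y \<noteq> 0"
  obtains c where "y = c *\<^sub>R x" "g x x = 0"
proof -
  \<comment> \<open>Otherwise \<open>x\<close> would be orthogonal to \<open>u0\<close> and hence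
    spacelike.\<close>
  have a: "g x u0 \<noteq> 0" using pos[of x] assms by force
  have b: "g y u0 \<noteq> 0" using pos[of y] assms by force
  define w where "w = g x u0 *\<^sub>R y - g y u0 *\<^sub>R x"
  have "g w w = (g x u0)\<^sup>2 * g y y + (g y u0)\<^sup>2 * g x x"
    using assms(3) sym[of x y] by (simp add: w_def power2_eq_square algebra_simps)
  also have "\<dots> \<le> 0"
    using assms by (intro add_nonpos_nonpos mult_nonneg_nonpos) auto
  finally have "g w w \<le> 0" .
  moreover have "g w u0 = 0" by (simp add: w_def)
  ultimately have "w = 0" using pos[of w] by force
  then have y: "y = (g y u0 / g x u0) *\<^sub>R x"
    using a by (simp add: w_def eq_vector_fraction_iff)
  then have "g x y = (g y u0 / g x u0) * g x x"
    by (metis bilinear_rmul[OF bil] real_scaleR_def)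
  then have "g x x = 0" using a b assms(3) by simp
  with y that show ?thesis by blast
qed

lemma orth_timelike_spacelike:
  assumes "g t t < 0" "g x t = 0" "x \<noteq> 0"
  shows "g x x > 0"
proof (rule ccontr)
  assume "\<not> ?thesis"
  then have "g x x \<le> 0" "g t x = 0" "t \<noteq> 0" using assms sym[of x t] by auto
  with orth_nonspacelike[of t x] assms show False by force
qed

text \<open>Orthogonal nonspacelike vectors are proportional, so in the hyperplane orthogonal to
  \<open>k\<close> only the line of \<open>k\<close> fails to be spacelike.\<close>

lemma orth_null_spacelike:
  assumes "g k k = 0" "k \<noteq> 0" "g x k = 0" "x \<notin> span {k}"
  shows "g x x > 0"
proof (rule ccontr)
  assume "\<not> ?thesis"
  moreover have "x \<noteq> 0" using assms span_zero by blast
  ultimately obtain c where "x = c *\<^sub>R k"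
    using orth_nonspacelike[of k x] assms sym[of x k] by force
  with assms show False by (simp add: span_base span_scale)
qed

lemma nondegenerate:
  assumes "\<And>x. g x y = 0"
  shows "y = 0"
  using pos[of y] assms[of y] assms[of u0] sym[of y u0] by force

end

section \<open>Invariant subspaces and complex pairs of a self-adjoint map\<close>

locale lorentz_selfadjoint = lorentz g u0
  for g :: "'a::euclidean_space \<Rightarrow> 'a \<Rightarrow> real" and u0 :: 'a +
  fixes L :: "'a \<Rightarrow> 'a"
  assumes lin: "linear L" and selfadj: "g (L x) y = g x (L y)"
begin

definition inv_subspace :: "'a set \<Rightarrow> bool" where
  "inv_subspace W \<longleftrightarrow> subspace W \<and> (\<forall>x\<in>W. L x \<in> W)"

text \<open>That is, \<open>L (x + i y) = (a + i b) (x + i y)\<close> with \<open>b \<noteq> 0\<close>.\<close>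

definition complex_pair :: "'a \<Rightarrow> 'a \<Rightarrow> real \<Rightarrow> real \<Rightarrow> bool" where
  "complex_pair x y a b \<longleftrightarrow> x \<noteq> 0 \<and> b \<noteq> 0 \<and>
     L x = a *\<^sub>R x - b *\<^sub>R y \<and> L y = b *\<^sub>R x + a *\<^sub>R y"

lemmas L_simps [simp] = linear_add[OF lin] linear_diff[OF lin] linear_cmul[OF lin] linear_0[OF lin]

lemma inv_subspaceD: "inv_subspace W \<Longrightarrow> subspace W" "inv_subspace W \<Longrightarrow> x \<in> W \<Longrightarrow> L x \<in> W"
  by (auto simp: inv_subspace_def)

lemma inv_subspace_cases:
  assumes "inv_subspace W" "dim W > 0"
  obtains (eigen) x r where "x \<in> W" "x \<noteq> 0" "L x = r *\<^sub>R x"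
  | (pair) x y a b where "x \<in> W" "y \<in> W" "complex_pair x y a b"
proof -
  obtain v where v: "v \<in> W" "v \<noteq> 0" using exists_nonzero_of_dim[OF assms(2)] .
  from invariant_subspace_cases[OF lin inv_subspaceD(1)[OF assms(1)] inv_subspaceD(2)[OF assms(1)] v]
  show ?thesis using that by (metis complex_pair_def)
qed

text \<open>Self-adjointness moves \<open>L\<close> onto \<open>v\<close>. This works for every
  causal character of \<open>v\<close>; a null \<open>v\<close> in \<open>W\<close> lies in its own
  complement.\<close>

lemma inv_subspace_orth:
  assumes "inv_subspace W" "L v = r *\<^sub>R v"
  shows "inv_subspace {x \<in> W. g x v = 0}"
  using assms orth_compl(1)[of W v] by (auto simp: inv_subspace_def selfadj)

lemma inv_subspace_orth_pair:
  assumes W: "inv_subspace W" and p: "complex_pair x y a b"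
  shows "inv_subspace {w \<in> W. g w x = 0 \<and> g w y = 0}"
    "dim W \<le> 2 + dim {w \<in> W. g w x = 0 \<and> g w y = 0}"
proof -
  have eq: "{w \<in> W. g w x = 0 \<and> g w y = 0} = {w \<in> {w \<in> W. g w x = 0}. g w y = 0}" by auto
  have s: "subspace {w \<in> W. g w x = 0}" using orth_compl W inv_subspaceD by blast
  show "inv_subspace {w \<in> W. g w x = 0 \<and> g w y = 0}"
    using W p orth_compl(1)[OF s, of y] unfolding eq
    by (auto simp: inv_subspace_def complex_pair_def selfadj)
  show "dim W \<le> 2 + dim {w \<in> W. g w x = 0 \<and> g w y = 0}"
    using orth_compl(2)[OF s, of y] orth_compl(2)[OF inv_subspaceD(1)[OF W], of x] unfolding eq
    by linarith
qed

lemma eigen_orth: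
  assumes "L x = r *\<^sub>R x" "L y = s *\<^sub>R y" "r \<noteq> s"
  shows "g x y = 0"
  using selfadj[of x y] assms by simp

text \<open>In \<open>g (L x) y = g x (L y)\<close> the terms with \<open>a\<close> cancel, which
  leaves \<open>- b * g y y = b * g x x\<close>.\<close>

lemma pair_trace:
  assumes "complex_pair x y a b"
  shows "g x x + g y y = 0"
proof -
  have "b * (g x x + g y y) = 0"
    using selfadj[of x y] assms unfolding complex_pair_def by (simp add: distrib_left)
  then show ?thesis using assms by (simp add: complex_pair_def)
qed

text \<open>Computing \<open>L y\<close> in two ways would give
  \<open>b (1 + c^2) x = 0\<close>.\<close>

lemma pair_independent:
  assumes "complex_pair x y a b"
  shows "y \<noteq> c *\<^sub>R x"
proof
  assume y: "y = c *\<^sub>R x"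
  then have "b *\<^sub>R x + a *\<^sub>R y = c *\<^sub>R (a *\<^sub>R x - b *\<^sub>R y)"
    using assms L_simps(3)[of c x] unfolding complex_pair_def by metis
  then have "(b * (1 + c\<^sup>2)) *\<^sub>R x = 0"
    by (simp add: y algebra_simps power2_eq_square)
  moreover have "1 + c\<^sup>2 \<noteq> 0" by (smt (verit) zero_le_power2)
  ultimately show False using assms by (simp add: complex_pair_def)
qed

text \<open>By the trace relation one of \<open>x\<close>, \<open>y\<close> is timelike unless both
  are null. Two null vectors that are not proportional have \<open>g x y\<close> nonzero, and then
  \<open>x - (g x y) y\<close> has square \<open>- 2 (g x y)^2\<close>.\<close>

lemma pair_timelike:
  assumes p: "complex_pair x y a b"
  obtains c d where "g (c *\<^sub>R x + d *\<^sub>R y) (c *\<^sub>R x + d *\<^sub>R y) < 0"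
proof -
  consider "g x x < 0" | "g y y < 0" | "g x x = 0" "g y y = 0"
    using pair_trace[OF p] by linarith
  then show ?thesis
  proof cases
    case 1 then show ?thesis using that[of 1 0] by simp
  next
    case 2 then show ?thesis using that[of 0 1] by simp
  next
    case 3
    have "g x y \<noteq> 0"
    proof
      assume "g x y = 0"
      moreover have "x \<noteq> 0" "y \<noteq> 0"
        using p pair_independent[OF p, of 0] by (auto simp: complex_pair_def)
      ultimately obtain c where "y = c *\<^sub>R x"
        using orth_nonspacelike[of x y] 3 by force
      with pair_independent[OF p] show False by blast
    qed
    then have "g (1 *\<^sub>R x + (- g x y) *\<^sub>R y) (1 *\<^sub>R x + (- g x y) *\<^sub>R y) < 0"
      using 3 sym[of y x] by (simp add: power2_eq_square[symmetric])
    then show ?thesis by (rule that)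
  qed
qed

lemma pair_orth_spacelike:
  assumes p: "complex_pair x y a b" and w: "g w x = 0" "g w y = 0" "w \<noteq> 0"
  shows "g w w > 0"
proof -
  obtain c d where "g (c *\<^sub>R x + d *\<^sub>R y) (c *\<^sub>R x + d *\<^sub>R y) < 0"
    using pair_timelike[OF p] .
  then show ?thesis by (rule orth_timelike_spacelike) (use w in auto)
qed

section \<open>Existence of spacelike eigenvectors\<close>

text \<open>A complex pair would need \<open>g x x + g y y = 0\<close> with both terms
  positive.\<close>

lemma spacelike_subspace_eigenvector:
  assumes W: "inv_subspace W" "dim W > 0" and sp: "\<And>x. x \<in> W \<Longrightarrow> x \<noteq> 0 \<Longrightarrow> g x x > 0"
  obtains x r where "x \<in> W" "g x x > 0" "x \<noteq> 0" "L x = r *\<^sub>R x"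
  using W
proof (cases rule: inv_subspace_cases)
  case (eigen x r)
  then show ?thesis using sp that by blast
next
  case (pair x y a b)
  then have "g x x > 0" "g y y > 0"
    using sp pair_independent[of x y a b 0] by (auto simp: complex_pair_def)
  with pair_trace pair show ?thesis by fastforce
qed

text \<open>The pair takes up at most two dimensions, and what remains orthogonal to it in
  \<open>W\<close> is a nonzero invariant positive definite subspace.\<close>

lemma pair_spacelike_eigenvector:
  assumes W: "inv_subspace W" "dim W \<ge> 3" and p: "complex_pair x y a b"
  obtains v r where "v \<in> W" "g v v > 0" "v \<noteq> 0" "L v = r *\<^sub>R v"
proof -
  let ?H = "{w \<in> W. g w x = 0 \<and> g w y = 0}"
  have H: "inv_subspace ?H" "dim ?H > 0"
    using inv_subspace_orth_pair[OF W(1) p] W(2) by auto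
  obtain v r where "v \<in> ?H" "g v v > 0" "v \<noteq> 0" "L v = r *\<^sub>R v"
    using spacelike_subspace_eigenvector[OF H] pair_orth_spacelike[OF p] by blast
  then show ?thesis using that by blast
qed

text \<open>This treats the degenerate complement of a null eigenvector. With
  \<open>M = L - r\<close>, either \<open>M\<close> maps \<open>K\<close> into the line of
  \<open>k\<close>, and its kernel then exceeds that line, or the image of \<open>K\<close> under
  \<open>M^2\<close> is a nonzero invariant positive definite subspace.\<close>

lemma spacelike_eigenvector_or_null:
  assumes K: "inv_subspace K" "dim K \<ge> 3"
    and k: "k \<in> K" "k \<noteq> 0" "g k k = 0" "L k = r *\<^sub>R k" and orth: "\<And>x. x \<in> K \<Longrightarrow> g x k = 0"
  obtains x s where "x \<in> K" "g x x > 0" "x \<noteq> 0" "L x = s *\<^sub>R x"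
proof -
  define M where "M x = L x - r *\<^sub>R x" for x
  have M: "linear M" unfolding M_def by (rule linearI) (simp_all add: algebra_simps)
  have MK: "M x \<in> K" if "x \<in> K" for x
    using that K unfolding M_def inv_subspace_def by (simp add: subspace_diff subspace_scale)
  have Msa: "g (M x) y = g x (M y)" for x y by (simp add: M_def selfadj)
  have Mk: "M k = 0" using k by (simp add: M_def)
  have LM: "L (M x) = M (L x)" for x by (simp add: M_def)
  have sp: "g x x > 0" if "x \<in> K" "x \<notin> span {k}" for x
    using orth_null_spacelike k that orth by blast
  show ?thesis
  proof (cases "\<forall>x\<in>K. M x \<in> span {k}")
    case True
    \<comment> \<open>Dimension three provides two directions \<open>a\<close>, \<open>b\<close> in
      \<open>K\<close> that are independent modulo \<open>k\<close>.\<close>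
    have "\<exists>a\<in>K. a \<notin> span {k}"
    proof (rule ccontr)
      assume "\<not> ?thesis"
      then have "K \<subseteq> span {k}" by blast
      then have "dim K \<le> card {k}" by (rule dim_le_card) simp
      with K show False by simp
    qed
    then obtain a where a: "a \<in> K" "a \<notin> span {k}" by blast
    have "\<exists>b\<in>K. b \<notin> span {a, k}"
    proof (rule ccontr)
      assume "\<not> ?thesis"
      then have "K \<subseteq> span {a, k}" by blast
      then have "dim K \<le> card {a, k}" by (rule dim_le_card) simp
      also have "\<dots> \<le> 2" by (simp add: card_insert_if)
      finally show False using K by simp
    qed
    then obtain b where b: "b \<in> K" "b \<notin> span {a, k}" by blast
    have "M a \<in> span {k}" "M b \<in> span {k}" using True a(1) b(1) by simp_all
    then obtain \<alpha> \<beta> where \<alpha>: "M a = \<alpha> *\<^sub>R k" and \<beta>: "M b = \<beta> *\<^sub>R k"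
      unfolding span_singleton by blast
    \<comment> \<open>A kernel vector of \<open>M\<close> off the line of \<open>k\<close>: if
      \<alpha> is nonzero, \<open>b\<close> enters with a nonzero coefficient, and \<open>b\<close>
      is outside the span of \<open>a\<close> and \<open>k\<close>.\<close>
    define x where "x = (if \<alpha> = 0 then a else \<alpha> *\<^sub>R b - \<beta> *\<^sub>R a)"
    have "M x = 0" using \<alpha> \<beta> by (simp add: x_def linear_diff[OF M] linear_cmul[OF M])
    then have "L x = r *\<^sub>R x" by (simp add: M_def)
    moreover have xK: "x \<in> K"
      using a b K by (simp add: x_def inv_subspace_def subspace_diff subspace_scale)
    moreover have "x \<notin> span {k}"
    proof (cases "\<alpha> = 0")
      case False
      show ?thesis
      proof
        assume "x \<in> span {k}"
        then have "x \<in> span {a, k}" by (meson span_mono subsetD subset_insertI)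
        then have "(1 / \<alpha>) *\<^sub>R (x + \<beta> *\<^sub>R a) \<in> span {a, k}"
          by (intro span_scale span_add) (auto intro: span_base)
        with b False show False by (simp add: x_def)
      qed
    qed (use a in \<open>simp add: x_def\<close>)
    ultimately have "x \<in> K" "g x x > 0" "x \<noteq> 0" "L x = r *\<^sub>R x"
      using sp[of x] span_zero[of "{k}"] by auto
    then show ?thesis by (rule that)
  next
    case False
    then obtain x0 where x0: "x0 \<in> K" "M x0 \<notin> span {k}" by blast
    \<comment> \<open>The image of \<open>M\<close> alone could contain the null vector
      \<open>k\<close>; the second application of \<open>M\<close> excludes this.\<close>
    define Y where "Y = (\<lambda>x. M (M x)) ` K"
    have "subspace Y" unfolding Y_def
      using linear_compose[OF M M] inv_subspaceD(1)[OF K(1)] by (intro linear_subspace_image) (simp add: o_def)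
    then have Y: "inv_subspace Y"
      using inv_subspaceD(2)[OF K(1)] by (auto simp: inv_subspace_def Y_def LM)
    have YK: "Y \<subseteq> K" using MK by (auto simp: Y_def)
    \<comment> \<open>The square of \<open>M y\<close> is \<open>g y (M (M y))\<close>, which is
      zero because \<open>K\<close> is orthogonal to \<open>k\<close>; so \<open>M y\<close> is not
      spacelike and lies on the line of \<open>k\<close>.\<close>
    have M2: "M y \<in> span {k}" if y: "y \<in> K" "M (M y) \<in> span {k}" for y
    proof (rule ccontr)
      assume "M y \<notin> span {k}"
      then have "g (M y) (M y) > 0" using sp MK y by blast
      moreover obtain c where "M (M y) = c *\<^sub>R k"
        using y(2) by (auto simp: span_singleton)
      then have "g y (M (M y)) = 0" using orth[OF y(1)] by simp
      ultimately show False by (simp add: Msa)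
    qed
    have spY: "g y y > 0" if "y \<in> Y" "y \<noteq> 0" for y
    proof -
      obtain z where z: "z \<in> K" "y = M (M z)" using \<open>y \<in> Y\<close> by (auto simp: Y_def)
      have "y \<notin> span {k}"
      proof
        assume "y \<in> span {k}"
        then have "M z \<in> span {k}" using M2 z by blast
        then obtain c where "M z = c *\<^sub>R k" by (auto simp: span_singleton)
        with Mk z \<open>y \<noteq> 0\<close> show False by (simp add: linear_cmul[OF M])
      qed
      then show ?thesis using sp YK \<open>y \<in> Y\<close> by blast
    qed
    have "M (M x0) \<noteq> 0" using M2[OF x0(1)] x0(2) span_zero by metis
    then have "dim Y > 0" using x0 dim_pos_of_nonzero[of "M (M x0)"] by (simp add: Y_def)
    from spacelike_subspace_eigenvector[OF Y this spY] show ?thesis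
      using that YK by blast
  qed
qed

text \<open>If the eigenvector found in \<open>W\<close> is not itself spacelike, one is sought in
  its complement, which is positive definite in the timelike case. The null case needs a complement
  of dimension at least three, whence the bound four.\<close>

lemma spacelike_eigenvector:
  assumes W: "inv_subspace W" "dim W \<ge> 4"
  obtains x r where "x \<in> W" "g x x > 0" "x \<noteq> 0" "L x = r *\<^sub>R x"
proof -
  have "dim W > 0" using W by simp
  from W(1) this show ?thesis
  proof (cases rule: inv_subspace_cases)
    case (eigen v r)
    let ?K = "{x \<in> W. g x v = 0}"
    have K: "inv_subspace ?K" using inv_subspace_orth[OF W(1) eigen(3)] .
    have dK: "dim ?K \<ge> 3" using orth_compl(2)[OF inv_subspaceD(1)[OF W(1)], of v] W by simp
    consider "g v v > 0" | "g v v < 0" | "g v v = 0" by linarith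
    then show ?thesis
    proof cases
      case 1 then show ?thesis using eigen that by blast
    next
      case 2
      have "g x x > 0" if "x \<in> ?K" "x \<noteq> 0" for x
        using orth_timelike_spacelike[OF 2] that by blast
      moreover have "dim ?K > 0" using dK by simp
      ultimately obtain x s where "x \<in> ?K" "g x x > 0" "x \<noteq> 0" "L x = s *\<^sub>R x"
        using spacelike_subspace_eigenvector[OF K] by blast
      with that show ?thesis by blast
    next
      case 3
      \<comment> \<open>Being null, \<open>v\<close> belongs to \<open>?K\<close>, and all of
        \<open>?K\<close> is orthogonal to it.\<close>
      then obtain x s where "x \<in> ?K" "g x x > 0" "x \<noteq> 0" "L x = s *\<^sub>R x"
        using spacelike_eigenvector_or_null[OF K dK _ eigen(2) 3 eigen(3)] eigen by blast
      with that show ?thesis by blast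
    qed
  next
    case (pair x y a b)
    show ?thesis
      by (rule pair_spacelike_eigenvector[OF W(1) _ pair(3)]) (use W that in auto)
  qed
qed

lemma eigenvector_of_dim_ge_3:
  assumes W: "inv_subspace W" "dim W \<ge> 3"
  obtains x r where "x \<in> W" "x \<noteq> 0" "L x = r *\<^sub>R x"
proof -
  have "dim W > 0" using W by simp
  from W(1) this show ?thesis
  proof (cases rule: inv_subspace_cases)
    case (pair x y a b)
    show ?thesis
      by (rule pair_spacelike_eigenvector[OF W(1) _ pair(3)]) (use W that in auto)
  qed (use that in blast)
qed

text \<open>Splitting off spacelike eigenvectors lowers the dimension bound from five to four and
  then to three. The first two steps need at least four dimensions; the third vector, of any causal
  character, needs three.\<close>

lemma three_orthogonal_eigenvectors:
  assumes "DIM('a) \<ge> 5"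
  obtains x y z where "x \<noteq> 0" "y \<noteq> 0" "z \<noteq> 0" "g x x > 0" "g y y > 0"
    "g y x = 0" "g z x = 0" "g z y = 0" "\<exists>r. L x = r *\<^sub>R x" "\<exists>r. L y = r *\<^sub>R y" "\<exists>r. L z = r *\<^sub>R z"
proof -
  have U: "inv_subspace UNIV" by (simp add: inv_subspace_def)
  obtain x r where x: "g x x > 0" "x \<noteq> 0" "L x = r *\<^sub>R x"
    by (rule spacelike_eigenvector[OF U]) (use assms in auto)
  define W1 where "W1 = {w \<in> UNIV. g w x = 0}"
  have W1: "inv_subspace W1" "dim W1 \<ge> 4"
    using inv_subspace_orth[OF U x(3)] orth_compl(2)[OF subspace_UNIV, of x] assms
    by (simp_all add: W1_def)
  obtain y s where y: "y \<in> W1" "g y y > 0" "y \<noteq> 0" "L y = s *\<^sub>R y"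
    using spacelike_eigenvector[OF W1] .
  define W2 where "W2 = {w \<in> W1. g w y = 0}"
  have W2: "inv_subspace W2" "dim W2 \<ge> 3"
    using inv_subspace_orth[OF W1(1) y(4)] orth_compl(2)[OF inv_subspaceD(1)[OF W1(1)], of y] W1
    by (simp_all add: W2_def)
  obtain z q where z: "z \<in> W2" "z \<noteq> 0" "L z = q *\<^sub>R z"
    using eigenvector_of_dim_ge_3[OF W2] .
  show ?thesis
    by (rule that[of x y z]) (use x y z in \<open>auto simp: W1_def W2_def\<close>)
qed

text \<open>Without complex pairs every nonzero invariant subspace has an eigenvector. As long as it
  is spacelike, passing to its complement lowers the dimension and keeps a timelike vector, so the
  descent ends at a nonspacelike one.\<close>

lemma nonspacelike_eigenvector:
  assumes "inv_subspace W" "t \<in> W" "g t t < 0" "\<And>x y a b. \<not> complex_pair x y a b"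
  shows "\<exists>v\<in>W. v \<noteq> 0 \<and> g v v \<le> 0 \<and> (\<exists>r. L v = r *\<^sub>R v)"
  using assms(1-3)
proof (induction "dim W" arbitrary: W t rule: less_induct)
  case less
  have "t \<noteq> 0" using less.prems(3) by auto
  then have "dim W > 0" using less.prems(2) dim_pos_of_nonzero by blast
  with less.prems(1) show ?case
  proof (cases rule: inv_subspace_cases)
    case (eigen v r)
    show ?thesis
    proof (cases "g v v > 0")
      case True
      let ?H = "{x \<in> W. g x v = 0}"
      have H: "inv_subspace ?H" using inv_subspace_orth[OF less.prems(1) eigen(3)] .
      have "v \<notin> ?H" using True by simp
      then have "?H \<subset> W" using eigen(1) by blast
      then have d: "dim ?H < dim W"
        using H less.prems(1) by (metis dim_psubset inv_subspaceD(1) span_eq_iff)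
      \<comment> \<open>The projection of \<open>t\<close> orthogonal to the spacelike
        \<open>v\<close> only loses a nonnegative amount of square, so it stays timelike.\<close>
      define t' where "t' = t - (g t v / g v v) *\<^sub>R v"
      have "t' \<in> ?H"
        using True less.prems(1,2) eigen(1)
        by (simp add: t'_def inv_subspace_def subspace_diff subspace_scale)
      moreover have "g t' t' = g t t - (g t v)\<^sup>2 / g v v"
        using True sym[of v t] by (simp add: t'_def power2_eq_square)
      then have "g t' t' < 0" using True less.prems(3)
        by (smt (verit) divide_nonneg_pos zero_le_power2)
      ultimately show ?thesis using less.hyps[OF d H] by blast
    qed (use eigen in \<open>auto simp: not_less\<close>)
  qed (use assms(4) in blast)
qed

section \<open>Eigenbases and timelike eigenvectors\<close>

text \<open>The usual spectral theorem: split off one eigenvector and continue in its orthogonal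
  complement.\<close>

lemma spacelike_subspace_eigenbasis:
  assumes "inv_subspace W" "\<And>x. x \<in> W \<Longrightarrow> x \<noteq> 0 \<Longrightarrow> g x x > 0"
  shows "\<exists>B\<subseteq>W. independent B \<and> W \<subseteq> span B \<and> (\<forall>v\<in>B. \<exists>r. L v = r *\<^sub>R v)"
  using assms
proof (induction "dim W" arbitrary: W rule: less_induct)
  case less
  show ?case
  proof (cases "dim W = 0")
    case True
    then have "W \<subseteq> span {}" by simp
    then show ?thesis using independent_empty by blast
  next
    case False
    then obtain v r where v: "v \<in> W" "g v v > 0" "v \<noteq> 0" "L v = r *\<^sub>R v"
      using spacelike_subspace_eigenvector[OF less.prems(1)] less.prems(2) by blast
    let ?H = "{x \<in> W. g x v = 0}"
    have H: "inv_subspace ?H" using inv_subspace_orth[OF less.prems(1) v(4)] .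
    have "v \<notin> ?H" using v(2) by simp
    then have "?H \<subset> W" using v(1) by blast
    then have d: "dim ?H < dim W"
      using H less.prems(1) by (metis dim_psubset inv_subspaceD(1) span_eq_iff)
    then obtain B where B: "B \<subseteq> ?H" "independent B" "?H \<subseteq> span B" "\<forall>v\<in>B. \<exists>r. L v = r *\<^sub>R v"
      using less.hyps[OF d H] less.prems(2) by blast
    have "span B \<subseteq> ?H" using B(1) inv_subspaceD(1)[OF H] by (simp add: span_minimal)
    with \<open>v \<notin> ?H\<close> have "v \<notin> span B" by blast
    then have "independent (insert v B)" using B(2) independent_insertI by blast
    moreover have "W \<subseteq> span (insert v B)"
    proof
      fix x assume "x \<in> W"
      then have "x - (g x v / g v v) *\<^sub>R v \<in> ?H"
        using v less.prems(1) by (simp add: inv_subspace_def subspace_diff subspace_scale)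
      then show "x \<in> span (insert v B)" unfolding span_insert using B(3) by blast
    qed
    moreover have "insert v B \<subseteq> W" using v B by blast
    moreover have "\<forall>w\<in>insert v B. \<exists>r. L w = r *\<^sub>R w" using v(4) B(4) by blast
    ultimately show ?thesis by blast
  qed
qed

text \<open>The complement of \<open>u\<close> is positive definite and invariant, hence has an
  eigenbasis, to which \<open>u\<close> is added.\<close>

lemma timelike_eigenbasis:
  assumes u: "g u u < 0" "L u = r *\<^sub>R u"
  obtains B where "independent B" "span B = UNIV" "\<And>v. v \<in> B \<Longrightarrow> \<exists>r. L v = r *\<^sub>R v"
proof -
  let ?H = "{x \<in> UNIV. g x u = 0}"
  have H: "inv_subspace ?H" using inv_subspace_orth[OF _ u(2), of UNIV] by (simp add: inv_subspace_def)
  obtain B where B: "B \<subseteq> ?H" "independent B" "?H \<subseteq> span B" "\<forall>v\<in>B. \<exists>r. L v = r *\<^sub>R v"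
    using spacelike_subspace_eigenbasis[OF H] orth_timelike_spacelike[OF u(1)] by blast
  have "span B \<subseteq> ?H" using B(1) inv_subspaceD(1)[OF H] by (simp add: span_minimal)
  moreover have "u \<notin> ?H" using u by simp
  ultimately have "u \<notin> span B" by blast
  then have "independent (insert u B)" using B(2) independent_insertI by blast
  moreover have "x \<in> span (insert u B)" for x
  proof -
    have "x - (g x u / g u u) *\<^sub>R u \<in> ?H" using u by simp
    then show ?thesis unfolding span_insert using B(3) by blast
  qed
  ultimately show ?thesis using that[of "insert u B"] u B(4) by blast
qed

text \<open>Grouping the terms of \<open>u0\<close> by eigenvalue gives mutually orthogonal
  eigencomponents \<open>p r\<close>. Their squares add up to \<open>g u0 u0 < 0\<close>, so one of
  them is negative.\<close>

lemma timelike_eigenvector_of_spanning: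
  fixes b :: "'i::finite \<Rightarrow> 'a"
  assumes b: "\<And>i. L (b i) = d i *\<^sub>R b i" and u: "u0 = (\<Sum>i\<in>UNIV. c i *\<^sub>R b i)"
  shows "\<exists>v r. g v v < 0 \<and> L v = r *\<^sub>R v"
proof -
  define p where "p r = (\<Sum>i | d i = r. c i *\<^sub>R b i)" for r
  have Lp: "L (p r) = r *\<^sub>R p r" for r
    unfolding p_def scaleR_sum_right linear_sum[OF lin]
    by (rule sum.cong) (auto simp: b mult.commute)
  have "u0 = (\<Sum>r\<in>range d. p r)"
    unfolding u p_def by (subst sum.image_gen[where g = d]) auto
  then have "g u0 u0 = (\<Sum>(r,s)\<in>range d \<times> range d. g (p r) (p s))"
    by (metis bilinear_sum[OF bil])
  also have "\<dots> = (\<Sum>r\<in>range d. \<Sum>s\<in>range d. if s = r then g (p r) (p r) else 0)"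
    unfolding sum.cartesian_product[symmetric]
    by (intro sum.cong) (auto simp: eigen_orth[OF Lp Lp])
  also have "\<dots> = (\<Sum>r\<in>range d. g (p r) (p r))" by simp
  finally have "(\<Sum>r\<in>range d. g (p r) (p r)) < 0" using u0 by simp
  then obtain r where "g (p r) (p r) < 0" by (meson not_less sum_nonneg)
  with Lp show ?thesis by blast
qed

section \<open>Null eigenvectors\<close>

text \<open>Null vectors on different lines are not orthogonal, so their eigenvalues agree. The
  combination \<open>k - (g k n) n\<close> stays in the common eigenspace and has square
  \<open>- 2 (g k n)^2\<close>.\<close>

lemma timelike_of_two_null:
  assumes k: "k \<noteq> 0" "g k k = 0" "L k = r *\<^sub>R k" and n: "n \<noteq> 0" "g n n = 0" "L n = s *\<^sub>R n"
    and kn: "n \<notin> span {k}"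
  obtains v where "g v v < 0" "L v = r *\<^sub>R v"
proof -
  have kn0: "g k n \<noteq> 0"
    using orth_null_spacelike[OF k(2,1) _ kn] n sym[of k n] by force
  with eigen_orth[OF k(3) n(3)] have "r = s" by blast
  with k n have "L (k - g k n *\<^sub>R n) = r *\<^sub>R (k - g k n *\<^sub>R n)" by (simp add: algebra_simps)
  moreover have "g (k - g k n *\<^sub>R n) (k - g k n *\<^sub>R n) < 0"
    using kn0 k n sym[of n k] by (simp add: power2_eq_square[symmetric])
  ultimately show ?thesis using that by blast
qed

text \<open>The vector \<open>n\<close> is the reflection of \<open>k\<close> in the hyperplane
  orthogonal to \<open>u\<close>. Since \<open>g k u\<close> is nonzero, \<open>k\<close> and
  \<open>u\<close> share an eigenvalue, and \<open>n\<close> inherits it.\<close>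

lemma reflected_null:
  assumes u: "g u u < 0" "L u = s *\<^sub>R u" and k: "k \<noteq> 0" "g k k = 0" "L k = r *\<^sub>R k"
  obtains n where "n \<noteq> 0" "g n n = 0" "L n = r *\<^sub>R n" "n \<notin> span {k}"
proof -
  have ku: "g k u \<noteq> 0" using orth_timelike_spacelike[OF u(1), of k] k by force
  with eigen_orth[OF k(3) u(2)] have "r = s" by blast
  define c where "c = 2 * g k u / g u u"
  define n where "n = k - c *\<^sub>R u"
  have c: "c \<noteq> 0" using ku u by (simp add: c_def)
  have "L n = r *\<^sub>R n" using u k \<open>r = s\<close> by (simp add: n_def algebra_simps)
  moreover have "g n n = 0"
    using u k sym[of u k] by (simp add: n_def c_def power2_eq_square)
  moreover have "n \<notin> span {k}"
  proof
    assume "n \<in> span {k}"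
    then have "(1 / c) *\<^sub>R (k - n) \<in> span {k}" by (intro span_scale span_diff) (auto intro: span_base)
    then have "u \<in> span {k}" using c by (simp add: n_def)
    then obtain q where "u = q *\<^sub>R k" by (auto simp: span_singleton)
    then show False using u k by simp
  qed
  moreover have "n \<noteq> 0" using \<open>n \<notin> span {k}\<close> span_zero by blast
  ultimately show ?thesis using that by blast
qed

text \<open>Self-adjointness gives a homogeneous linear system for \<open>g x k\<close> and
  \<open>g y k\<close> with determinant \<open>(a - r)^2 + b^2 > 0\<close>. So \<open>k\<close> is
  orthogonal to the pair, which would make it spacelike.\<close>

lemma null_eigenvector_no_pair:
  assumes k: "k \<noteq> 0" "g k k = 0" "L k = r *\<^sub>R k"
  shows "\<not> complex_pair x y a b"
proof
  assume p: "complex_pair x y a b"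
  have "a * g x k - b * g y k = r * g x k" "b * g x k + a * g y k = r * g y k"
    using selfadj[of x k] selfadj[of y k] p k(3) unfolding complex_pair_def by simp_all
  then have "((a - r)\<^sup>2 + b\<^sup>2) * g x k = 0" "((a - r)\<^sup>2 + b\<^sup>2) * g y k = 0"
    unfolding power2_eq_square by algebra+
  moreover have "(a - r)\<^sup>2 + b\<^sup>2 \<noteq> 0" using p by (simp add: complex_pair_def sum_power2_eq_zero_iff)
  ultimately have "g k x = 0" "g k y = 0" using sym by auto
  then have "g k k > 0" using pair_orth_spacelike[OF p] k by blast
  with k show False by simp
qed

end

section \<open>Matrices and frames\<close>

lemma matrix_inv_inverse:
  assumes "invertible A"
  shows "A ** matrix_inv A = mat 1" "matrix_inv A ** A = mat 1"
  using someI_ex[OF assms[unfolded invertible_def]] unfolding matrix_inv_def by auto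

text \<open>The columns of \<open>P\<close> serve as \<open>b\<close>: they are eigenvectors by
  \<open>A ** P = P ** D\<close>, and they span because \<open>P\<close> is invertible.\<close>

lemma diagonable_real_spanning:
  fixes A :: "real^'n^'n"
  assumes "diagonable_real A"
  obtains b d where "\<And>i::'n. A *v b i = d i *\<^sub>R b i" "\<And>x. \<exists>c. x = (\<Sum>i\<in>UNIV. c i *\<^sub>R b i)"
proof -
  obtain P :: "real^'n^'n" where P: "invertible P" and D: "\<forall>i j. i \<noteq> j \<longrightarrow> (matrix_inv P ** A ** P) $ i $ j = 0"
    using assms unfolding diagonable_real_def by blast
  define D where "D = matrix_inv P ** A ** P"
  have AP: "A ** P = P ** D"
    by (simp add: D_def matrix_mul_assoc matrix_inv_inverse[OF P])
  have "A *v column i P = D $ i $ i *\<^sub>R column i P" for i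
  proof -
    have "D *v axis i 1 = D $ i $ i *\<^sub>R axis i 1"
      using D by (simp add: vec_eq_iff matrix_vector_mul_component inner_axis D_def) (simp add: axis_def)
    then have "P *v (D *v axis i 1) = D $ i $ i *\<^sub>R (P *v axis i 1)"
      by (simp add: matrix_vector_mult_scaleR)
    then show ?thesis
      by (metis AP matrix_vector_mul_assoc matrix_vector_mult_basis)
  qed
  moreover have "\<exists>c. x = (\<Sum>i\<in>UNIV. c i *\<^sub>R column i P)" for x
  proof -
    have "x = P *v (matrix_inv P *v x)"
      by (simp add: matrix_vector_mul_assoc matrix_inv_inverse[OF P])
    also have "\<dots> = (\<Sum>i\<in>UNIV. (matrix_inv P *v x) $ i *\<^sub>R column i P)"
      by (simp add: matrix_mult_sum[of P] scalar_mult_eq_scaleR)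
    finally show ?thesis by blast
  qed
  ultimately show ?thesis by (rule that)
qed

text \<open>The basis has as many elements as the index type, so it can be enumerated as the columns
  of \<open>P\<close>.\<close>

lemma diagonable_real_of_eigenbasis:
  fixes A :: "real^'n^'n"
  assumes B: "independent B" "span B = UNIV" and eig: "\<And>v. v \<in> B \<Longrightarrow> \<exists>r. A *v v = r *\<^sub>R v"
  shows "diagonable_real A"
proof -
  have "finite B" using B(1) independent_imp_finite by blast
  moreover have "card B = CARD('n)"
    using B by (metis DIM_cart DIM_real dim_UNIV dim_span_eq_card_independent mult.right_neutral)
  ultimately obtain h :: "'n \<Rightarrow> real^'n" where h: "bij_betw h UNIV B"
    by (metis finite_class.finite_UNIV finite_same_card_bij)
  then have "\<forall>i. \<exists>r. A *v h i = r *\<^sub>R h i" using eig by (auto simp: bij_betw_def)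
  then obtain d where d: "\<And>i. A *v h i = d i *\<^sub>R h i" by metis
  define P where "P = (\<chi> i j. h j $ i)"
  define D :: "real^'n^'n" where "D = (\<chi> i j. if i = j then d i else 0)"
  have col: "column i P = h i" for i by (simp add: column_def P_def vec_eq_iff)
  then have "columns P = B" using h by (auto simp: columns_def bij_betw_def)
  then have P: "invertible P"
    using B matrix_right_invertible_span_columns[of P] by (auto simp: invertible_right_inverse span_vec_eq)
  have "(A ** P) $ i $ j = (P ** D) $ i $ j" for i j
  proof -
    have "(A ** P) $ i $ j = (A *v h j) $ i"
      by (simp add: matrix_matrix_mult_def matrix_vector_mult_def P_def)
    also have "\<dots> = d j * h j $ i" by (simp add: d)
    also have "\<dots> = (P ** D) $ i $ j"
      by (simp add: matrix_matrix_mult_def P_def D_def if_distrib cong: if_cong)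
    finally show ?thesis .
  qed
  then have "A ** P = P ** D" by (simp add: vec_eq_iff)
  then have "matrix_inv P ** A ** P = D"
    using matrix_inv_inverse[OF P] by (metis matrix_mul_assoc matrix_mul_lid)
  then show ?thesis using P by (auto simp: diagonable_real_def D_def)
qed

section \<open>Complex eigenvalues in real terms\<close>

lemma eigenvalue_iff:
  fixes A :: "real^'n^'n"
  shows "eigenvalue A l \<longleftrightarrow> (\<exists>z. z \<noteq> 0 \<and> complex_matrix A *v z = l *s z)"
proof -
  have "mat l *v z = l *s z" for z :: "complex^'n"
    by (simp add: vec_eq_iff matrix_vector_mult_def mat_def if_distrib cong: if_cong)
      (simp add: if_distribR sum.delta' cong: if_cong)
  then have "(complex_matrix A - mat l) *v z = 0 \<longleftrightarrow> complex_matrix A *v z = l *s z" for z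
    by (simp add: matrix_vector_mult_diff_rdistrib)
  moreover have "eigenvalue A l \<longleftrightarrow> \<not> (\<forall>z. (complex_matrix A - mat l) *v z = 0 \<longrightarrow> z = 0)"
    unfolding eigenvalue_def matrix_left_invertible_ker[symmetric] invertible_left_inverse[symmetric]
    by (simp add: invertible_det_nz)
  ultimately show ?thesis by auto
qed

lemma complex_matrix_mult:
  fixes A :: "real^'n^'n"
  shows "complex_matrix A *v (\<chi> i. Complex (x $ i) (y $ i)) = (\<chi> i. Complex ((A *v x) $ i) ((A *v y) $ i))"
  by (simp add: vec_eq_iff matrix_vector_mult_def complex_matrix_def complex_eq_iff)

lemma complex_eigenvector_iff:
  fixes A :: "real^'n^'n"
  shows "complex_matrix A *v (\<chi> i. Complex (x $ i) (y $ i)) = l *s (\<chi> i. Complex (x $ i) (y $ i)) \<longleftrightarrow>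
    A *v x = Re l *\<^sub>R x - Im l *\<^sub>R y \<and> A *v y = Im l *\<^sub>R x + Re l *\<^sub>R y"
  unfolding complex_matrix_mult by (auto simp: vec_eq_iff complex_eq_iff algebra_simps)

text \<open>The vectors \<open>x\<close> and \<open>y\<close> are the real and imaginary parts of an
  eigenvector for \<open>a + i b\<close>. This ties the characteristic equation to complex
  pairs.\<close>

lemma nonreal_eigenvalue_iff:
  fixes A :: "real^'n^'n"
  shows "(\<exists>l. eigenvalue A l \<and> l \<notin> \<real>) \<longleftrightarrow> (\<exists>x y a b. x \<noteq> 0 \<and> b \<noteq> 0 \<and>
    A *v x = a *\<^sub>R x - b *\<^sub>R y \<and> A *v y = b *\<^sub>R x + a *\<^sub>R y)"
proof
  assume "\<exists>l. eigenvalue A l \<and> l \<notin> \<real>"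
  then obtain l z where l: "l \<notin> \<real>" and z: "z \<noteq> 0" "complex_matrix A *v z = l *s z"
    unfolding eigenvalue_iff by blast
  define x y where "x = (\<chi> i. Re (z $ i))" and "y = (\<chi> i. Im (z $ i))"
  have zxy: "z = (\<chi> i. Complex (x $ i) (y $ i))" by (simp add: vec_eq_iff x_def y_def)
  then have e: "A *v x = Re l *\<^sub>R x - Im l *\<^sub>R y" "A *v y = Im l *\<^sub>R x + Re l *\<^sub>R y"
    using z(2) complex_eigenvector_iff by auto
  have b: "Im l \<noteq> 0" using l by (simp add: complex_is_Real_iff)
  \<comment> \<open>With \<open>x = 0\<close> the first real equation reads \<open>b y = 0\<close>,
    and the whole eigenvector would vanish.\<close>
  have "x \<noteq> 0"
  proof
    assume "x = 0"
    with e(1) b have "y = 0" by simp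
    with \<open>x = 0\<close> zxy z(1) show False by (simp add: vec_eq_iff complex_eq_iff)
  qed
  with b e show "\<exists>x y a b. x \<noteq> 0 \<and> b \<noteq> 0 \<and>
      A *v x = a *\<^sub>R x - b *\<^sub>R y \<and> A *v y = b *\<^sub>R x + a *\<^sub>R y" by blast
next
  assume "\<exists>x y a b. x \<noteq> 0 \<and> b \<noteq> 0 \<and>
    A *v x = a *\<^sub>R x - b *\<^sub>R y \<and> A *v y = b *\<^sub>R x + a *\<^sub>R y"
  then obtain x y a b where p: "x \<noteq> 0" "b \<noteq> 0"
    "A *v x = a *\<^sub>R x - b *\<^sub>R y" "A *v y = b *\<^sub>R x + a *\<^sub>R y" by blast
  let ?z = "(\<chi> i. Complex (x $ i) (y $ i))"
  have "complex_matrix A *v ?z = Complex a b *s ?z"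
    unfolding complex_eigenvector_iff using p by simp
  moreover have "?z \<noteq> 0" using p(1) by (auto simp: vec_eq_iff complex_eq_iff)
  ultimately have "eigenvalue A (Complex a b)" unfolding eigenvalue_iff by blast
  moreover have "Complex a b \<notin> \<real>" using p(2) by (simp add: complex_is_Real_iff)
  ultimately show "\<exists>l. eigenvalue A l \<and> l \<notin> \<real>" by blast
qed

text \<open>The imaginary part of the eigenvalue equation is \<open>Im l\<close> times
  \<open>x\<close>, so a real eigenvector forces a real eigenvalue.\<close>

lemma eigenvector_complex_vector_iff:
  fixes A :: "real^'n^'n"
  shows "eigenvector A l (complex_vector x) \<longleftrightarrow> x \<noteq> 0 \<and> l \<in> \<real> \<and> A *v x = Re l *\<^sub>R x"
proof -
  have c: "complex_vector x = (\<chi> i. Complex (x $ i) ((0::real^'n) $ i))"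
    by (simp add: complex_vector_def vec_eq_iff complex_eq_iff)
  have "complex_matrix A *v complex_vector x = l *s complex_vector x \<longleftrightarrow>
      A *v x = Re l *\<^sub>R x \<and> Im l *\<^sub>R x = 0"
    unfolding c complex_eigenvector_iff by auto
  moreover have "complex_vector x \<noteq> 0 \<longleftrightarrow> x \<noteq> 0"
    by (auto simp: complex_vector_def vec_eq_iff)
  ultimately show ?thesis unfolding eigenvector_def by (auto simp: complex_is_Real_iff)
qed

section \<open>Transfer between tangent vectors and coordinates\<close>

text \<open>For a frame this inverts \<open>components\<close>. Forms are pulled back along it to
  coordinate space, a Euclidean space where the results on \<open>lorentz\<close> apply.\<close>

definition frame_vector :: "('n::finite \<Rightarrow> 'v::real_vector) \<Rightarrow> real^'n \<Rightarrow> 'v" where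
  "frame_vector e x = (\<Sum>a\<in>UNIV. x $ a *\<^sub>R e a)"

lemma linear_frame_vector: "linear (frame_vector e)"
  by (rule linearI) (simp_all add: frame_vector_def scaleR_add_left sum.distrib scaleR_sum_right)

lemma frame_vector_components:
  assumes "frame e"
  shows "frame_vector e (components e v) = v"
proof -
  have e: "inj e" "independent (range e)" "v \<in> span (range e)" using assms by (auto simp: frame_def)
  have "frame_vector e (components e v) = (\<Sum>b\<in>range e. representation (range e) v b *\<^sub>R b)"
    by (simp add: frame_vector_def components_def sum.reindex[OF e(1)])
  also have "\<dots> = v"
    using e by (intro real_vector.sum_representation_eq) auto
  finally show ?thesis .
qed

lemma components_frame_vector:
  assumes "frame e"
  shows "components e (frame_vector e x) = x"
proof -
  have e: "inj e" "independent (range e)" "span (range e) = UNIV" using assms by (auto simp: frame_def)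
  have "representation (range e) (frame_vector e x) (e a) = x $ a" for a
    unfolding frame_vector_def using e
    by (simp add: real_vector.representation_sum real_vector.representation_scale
        real_vector.representation_basis inj_eq if_distrib cong: if_cong)
  then show ?thesis by (simp add: components_def vec_eq_iff)
qed

lemma frame_vector_eq_0_iff:
  assumes "frame e"
  shows "frame_vector e x = 0 \<longleftrightarrow> x = 0"
  by (metis assms components_frame_vector linear_0 linear_frame_vector)

lemma tangent_eigenvector_frame_vector:
  assumes "frame e"
  shows "tangent_eigenvector e A l (frame_vector e x) \<longleftrightarrow> x \<noteq> 0 \<and> l \<in> \<real> \<and> A *v x = Re l *\<^sub>R x"
  by (simp add: tangent_eigenvector_def components_frame_vector[OF assms] eigenvector_complex_vector_iff)

lemma exists_tangent_eigenvector_frame_vector: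
  assumes "frame e"
  shows "(\<exists>l. tangent_eigenvector e A l (frame_vector e x)) \<longleftrightarrow> x \<noteq> 0 \<and> (\<exists>r. A *v x = r *\<^sub>R x)"
  unfolding tangent_eigenvector_frame_vector[OF assms] by (metis Re_complex_of_real Reals_of_real)

lemma bilinear_frame_vector:
  assumes "bilinear h"
  shows "bilinear (\<lambda>x y. h (frame_vector e x) (frame_vector e y))"
  using assms linear_compose[OF linear_frame_vector[of e]]
  unfolding bilinear_def o_def by fast

lemma frame_vector_form:
  fixes e :: "'n::finite \<Rightarrow> 'v::real_vector"
  assumes "bilinear h"
  shows "h (frame_vector e x) (frame_vector e y) = x \<bullet> (lower_components e h *v y)"
proof -
  have "h (frame_vector e x) (frame_vector e y) = (\<Sum>a\<in>UNIV. \<Sum>b\<in>UNIV. h (x $ a *\<^sub>R e a) (y $ b *\<^sub>R e b))"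
    unfolding frame_vector_def bilinear_sum[OF assms] sum.cartesian_product ..
  also have "\<dots> = x \<bullet> (lower_components e h *v y)"
    by (simp add: bilinear_lmul[OF assms] bilinear_rmul[OF assms] inner_vec_def matrix_vector_mult_def
        lower_components_def sum_distrib_left mult_ac)
  finally show ?thesis .
qed

text \<open>The timelike member \<open>E t\<close> of an orthonormal frame serves as
  \<open>u0\<close>. A vector orthogonal to it has zero \<open>t\<close>-coordinate in
  \<open>E\<close>, so its square is the Euclidean one.\<close>

lemma lorentz_frame_vector:
  fixes e :: "'n::finite \<Rightarrow> 'v::real_vector"
  assumes e: "frame e" and g: "lorentzian TYPE('n) g"
  obtains u where "lorentz (\<lambda>x y. g (frame_vector e x) (frame_vector e y)) u"
proof -
  have sg: "symmetric_form g" using g by (simp add: lorentzian_def)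
  then have bg: "bilinear g" by (simp add: symmetric_form_def)
  obtain E :: "'n \<Rightarrow> 'v" and t where E: "frame E" and
    gE: "\<And>a b. g (E a) (E b) = (if a \<noteq> b then 0 else if a = t then -1 else 1)"
    using g unfolding lorentzian_def by blast
  have G: "lower_components E g *v y = (\<chi> a. if a = t then - y $ a else y $ a)" for y
  proof -
    have "(lower_components E g *v y) $ a = (\<Sum>b\<in>UNIV. if b = a then if a = t then - y $ a else y $ a else 0)" for a
      by (simp only: matrix_vector_mult_def lower_components_def vec_lambda_beta gE)
        (rule sum.cong, auto)
    then show ?thesis by (simp add: vec_eq_iff)
  qed
  have gpos: "g v v > 0" if v: "v \<noteq> 0" "g v (E t) = 0" for v
  proof -
    define c where "c = components E v"
    have vc: "v = frame_vector E c" by (simp add: c_def frame_vector_components[OF E])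
    have "frame_vector E (axis t 1) = (\<Sum>b\<in>UNIV. if b = t then E b else 0)"
      unfolding frame_vector_def by (rule sum.cong) (auto simp: axis_def)
    then have Et: "E t = frame_vector E (axis t 1)" by simp
    have "(\<chi> a. if a = t then - axis t 1 $ a else axis t 1 $ a) = - (axis t 1 :: real^'n)"
      by (simp add: vec_eq_iff axis_def)
    then have "g v (E t) = - c $ t"
      unfolding vc Et frame_vector_form[OF bg] G by (simp add: inner_axis)
    then have ct: "c $ t = 0" using v by simp
    have "g v v = c \<bullet> c"
      unfolding vc frame_vector_form[OF bg] G inner_vec_def
      by (intro sum.cong) (auto simp: ct)
    moreover have "c \<noteq> 0" using v vc linear_0[OF linear_frame_vector] by metis
    ultimately show ?thesis by simp
  qed
  have "lorentz (\<lambda>x y. g (frame_vector e x) (frame_vector e y)) (components e (E t))"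
  proof
    show "bilinear (\<lambda>x y. g (frame_vector e x) (frame_vector e y))"
      using bg by (rule bilinear_frame_vector)
    show "g (frame_vector e x) (frame_vector e y) = g (frame_vector e y) (frame_vector e x)" for x y
      using sg by (simp add: symmetric_form_def)
  qed (use gpos in \<open>auto simp: frame_vector_components[OF e] gE frame_vector_eq_0_iff[OF e]\<close>)
  then show ?thesis by (rule that)
qed

section \<open>The four claims about the tensor\<close>

theorem theorem2:
  fixes g T :: "'v::real_vector \<Rightarrow> 'v \<Rightarrow> real"
    and e :: "5 \<Rightarrow> 'v"
    and A :: "real^5^5"
  assumes frame: "frame e"
    and metric: "lorentzian TYPE(5) g"
    and tensor: "symmetric_form T"
    and mixed: "A = mixed_components e g T"
  shows
    "((\<exists>v l. timelike g v \<and> tangent_eigenvector e A l v) \<longleftrightarrow> diagonable_real A)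
     \<and> (\<exists>S. card S = 3 \<and> independent S \<and> pairwise (orthogonal_wrt g) S
            \<and> (\<forall>v\<in>S. \<exists>l. tangent_eigenvector e A l v)
            \<and> card {v \<in> S. spacelike g v} \<ge> 2)
     \<and> ((\<forall>l. eigenvalue A l \<longrightarrow> l \<in> \<real>) \<and> \<not> diagonable_real A
          \<longleftrightarrow> (\<exists>!D. null_eigendirection e g A D))
     \<and> (\<forall>k n l m. null g k \<and> null g n \<and> k \<noteq> n \<and> independent {k, n}
            \<and> tangent_eigenvector e A l k \<and> tangent_eigenvector e A m n
          \<longrightarrow> diagonable_real A \<and> l \<in> \<real> \<and> m \<in> \<real>)"
proof -
  define V where "V = frame_vector e"
  define h where "h x y = g (V x) (V y)" for x y
  have bg: "bilinear g" and bT: "bilinear T" and symT: "T v w = T w v" for v w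
    using metric tensor by (auto simp: lorentzian_def symmetric_form_def)
  obtain u where "lorentz h u"
    using lorentz_frame_vector[OF frame metric] unfolding h_def V_def .
  then interpret lorentz h u .
  let ?G = "lower_components e g"
  have hG: "h x y = x \<bullet> (?G *v y)" for x y
    by (simp add: h_def V_def frame_vector_form[OF bg])
  \<comment> \<open>Nondegeneracy makes the metric matrix invertible, so raising the index with
    \<open>matrix_inv\<close> can be undone.\<close>
  have "y = 0" if "?G *v y = 0" for y
    by (rule nondegenerate) (simp add: hG that)
  then have "invertible ?G"
    unfolding invertible_left_inverse matrix_left_invertible_ker by blast
  then have "?G ** A = lower_components e T"
    by (simp add: mixed mixed_components_def matrix_mul_assoc matrix_inv_inverse)
  \<comment> \<open>Lowering the index of \<open>A\<close> gives back \<open>T\<close>; the symmetry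
    of \<open>T\<close> thereby becomes self-adjointness of \<open>A\<close>.\<close>
  then have hA: "h x (A *v y) = T (V x) (V y)" for x y
    by (simp add: hG V_def frame_vector_form[OF bT] matrix_vector_mul_assoc)
  interpret lorentz_selfadjoint h u "(*v) A"
  proof
    show "h (A *v x) y = h x (A *v y)" for x y
      by (metis hA symT sym)
  qed (simp_all add: matrix_vector_right_distrib matrix_vector_mult_scaleR)
  have V_surj: "\<exists>x. v = V x" for v using frame_vector_components[OF frame] unfolding V_def by metis
  have linV: "linear V" by (simp add: V_def linear_frame_vector)
  have V0: "V x = 0 \<longleftrightarrow> x = 0" for x by (simp add: V_def frame_vector_eq_0_iff[OF frame])
  have V_inj: "inj V" using V0 linV linear_injective_0 by blast
  have V_span: "V x \<in> span {V y} \<longleftrightarrow> x \<in> span {y}" for x y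
    using V_inj by (auto simp: span_singleton inj_eq simp flip: linear_cmul[OF linV])
  have tan: "tangent_eigenvector e A l (V x) \<longleftrightarrow> x \<noteq> 0 \<and> l \<in> \<real> \<and> A *v x = Re l *\<^sub>R x" for l x
    unfolding V_def by (rule tangent_eigenvector_frame_vector[OF frame])
  have ex_tan: "(\<exists>l. tangent_eigenvector e A l (V x)) \<longleftrightarrow> x \<noteq> 0 \<and> (\<exists>r. A *v x = r *\<^sub>R x)" for x
    unfolding V_def by (rule exists_tangent_eigenvector_frame_vector[OF frame])
  have null_V: "null g (V x) \<longleftrightarrow> x \<noteq> 0 \<and> h x x = 0" for x by (simp add: null_def V0 h_def)

  have "(\<exists>v l. timelike g v \<and> tangent_eigenvector e A l v) \<longleftrightarrow> (\<exists>x r. h x x < 0 \<and> A *v x = r *\<^sub>R x)"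
  proof
    assume "\<exists>v l. timelike g v \<and> tangent_eigenvector e A l v"
    then show "\<exists>x r. h x x < 0 \<and> A *v x = r *\<^sub>R x"
      by (metis V_surj ex_tan h_def timelike_def)
  next
    assume "\<exists>x r. h x x < 0 \<and> A *v x = r *\<^sub>R x"
    then obtain x r where x: "h x x < 0" "A *v x = r *\<^sub>R x" by blast
    then have "x \<noteq> 0" by auto
    with x ex_tan[of x] have "timelike g (V x)" "\<exists>l. tangent_eigenvector e A l (V x)"
      by (auto simp: timelike_def V0 h_def)
    then show "\<exists>v l. timelike g v \<and> tangent_eigenvector e A l v" by blast
  qed
  \<comment> \<open>The coordinate form of the first claim, used again for the third and
    fourth.\<close>
  moreover have diag: "diagonable_real A \<longleftrightarrow> (\<exists>x r. h x x < 0 \<and> A *v x = r *\<^sub>R x)"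
  proof
    assume "diagonable_real A"
    then obtain b :: "5 \<Rightarrow> real^5" and d where b: "\<And>i. A *v b i = d i *\<^sub>R b i" "\<And>x. \<exists>c. x = (\<Sum>i\<in>UNIV. c i *\<^sub>R b i)"
      using diagonable_real_spanning by blast
    obtain c where "u = (\<Sum>i\<in>UNIV. c i *\<^sub>R b i)" using b(2) by blast
    with b(1) show "\<exists>x r. h x x < 0 \<and> A *v x = r *\<^sub>R x"
      by (rule timelike_eigenvector_of_spanning)
  next
    assume "\<exists>x r. h x x < 0 \<and> A *v x = r *\<^sub>R x"
    then obtain B where "independent B" "span B = UNIV" "\<And>v. v \<in> B \<Longrightarrow> \<exists>r. A *v v = r *\<^sub>R v"
      using timelike_eigenbasis by blast
    then show "diagonable_real A" by (rule diagonable_real_of_eigenbasis)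
  qed
  ultimately have part1: "(\<exists>v l. timelike g v \<and> tangent_eigenvector e A l v) \<longleftrightarrow> diagonable_real A"
    by simp

  have part2: "\<exists>S. card S = 3 \<and> independent S \<and> pairwise (orthogonal_wrt g) S
      \<and> (\<forall>v\<in>S. \<exists>l. tangent_eigenvector e A l v) \<and> card {v \<in> S. spacelike g v} \<ge> 2"
  proof -
    obtain x y z where nz: "x \<noteq> 0" "y \<noteq> 0" "z \<noteq> 0" and sp: "h x x > 0" "h y y > 0"
      and o: "h y x = 0" "h z x = 0" "h z y = 0"
      and eig: "\<exists>r. A *v x = r *\<^sub>R x" "\<exists>r. A *v y = r *\<^sub>R y" "\<exists>r. A *v z = r *\<^sub>R z"
      by (rule three_orthogonal_eigenvectors) auto
    have o': "h x y = 0" "h x z = 0" "h y z = 0" using o sym by metis+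
    have d: "y \<noteq> z" "x \<noteq> y" "x \<noteq> z" using sp o by auto
    \<comment> \<open>Since \<open>z\<close> may be null or timelike, independence is drawn from
      orthogonality and from \<open>x\<close> and \<open>y\<close> being spacelike.\<close>
    have "y \<notin> span {z}" using sp o by (auto simp: span_singleton)
    moreover have "x \<notin> span {y, z}"
    proof
      assume "x \<in> span {y, z}"
      moreover have "span {y, z} \<subseteq> {w \<in> UNIV. h w x = 0}"
        using o by (intro span_minimal orth_compl(1)) auto
      ultimately show False using sp by auto
    qed
    ultimately have "independent {x, y, z}"
      using nz d by (simp add: independent_insert)
    then have "independent (V ` {x, y, z})"
      using V_inj linV by (metis linear_independent_injective_image inj_on_subset subset_UNIV)
    moreover have "card (V ` {x, y, z}) = 3"
      using d by (simp add: inj_eq[OF V_inj])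
    moreover have "pairwise (orthogonal_wrt g) (V ` {x, y, z})"
      using o o' by (auto simp: pairwise_def orthogonal_wrt_def h_def)
    moreover have "\<forall>v\<in>V ` {x, y, z}. \<exists>l. tangent_eigenvector e A l v"
      using nz eig by (auto simp: ex_tan)
    moreover have "card {v \<in> V ` {x, y, z}. spacelike g v} \<ge> 2"
    proof -
      have "V ` {x, y} \<subseteq> {v \<in> V ` {x, y, z}. spacelike g v}"
        using nz sp by (auto simp: spacelike_def V0 h_def)
      then have "card (V ` {x, y}) \<le> card {v \<in> V ` {x, y, z}. spacelike g v}"
        by (intro card_mono) auto
      then show ?thesis using d by (simp add: inj_eq[OF V_inj])
    qed
    ultimately show ?thesis by blast
  qed

  have two_null: "diagonable_real A"
    if "x \<noteq> 0" "h x x = 0" "A *v x = r *\<^sub>R x" "y \<noteq> 0" "h y y = 0" "A *v y = s *\<^sub>R y" "y \<notin> span {x}"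
    for x y r s
    using timelike_of_two_null[OF that] diag by metis
  have null_dir: "null_eigendirection e g A D \<longleftrightarrow>
      (\<exists>x r. x \<noteq> 0 \<and> h x x = 0 \<and> A *v x = r *\<^sub>R x \<and> D = span {V x})" for D
    unfolding null_eigendirection_def by (metis V_surj null_V ex_tan)
  have real_spectrum: "(\<forall>l. eigenvalue A l \<longrightarrow> l \<in> \<real>) \<longleftrightarrow> (\<forall>x y a b. \<not> complex_pair x y a b)"
    using nonreal_eigenvalue_iff[of A] unfolding complex_pair_def by blast
  have part3: "(\<forall>l. eigenvalue A l \<longrightarrow> l \<in> \<real>) \<and> \<not> diagonable_real A
      \<longleftrightarrow> (\<exists>!D. null_eigendirection e g A D)"
  proof
    assume *: "(\<forall>l. eigenvalue A l \<longrightarrow> l \<in> \<real>) \<and> \<not> diagonable_real A"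
    have "inv_subspace UNIV" by (simp add: inv_subspace_def)
    \<comment> \<open>A real spectrum excludes pairs, so a nonspacelike eigenvector exists; it is
      null because a timelike one would make \<open>A\<close> diagonable.\<close>
    then obtain x r where x: "x \<noteq> 0" "h x x \<le> 0" "A *v x = r *\<^sub>R x"
      using nonspacelike_eigenvector[of UNIV u] u0 * real_spectrum by blast
    then have x0: "h x x = 0" using * diag by force
    show "\<exists>!D. null_eigendirection e g A D"
    proof
      show "null_eigendirection e g A (span {V x})" using x x0 null_dir by blast
    next
      fix D assume "null_eigendirection e g A D"
      then obtain y s where y: "y \<noteq> 0" "h y y = 0" "A *v y = s *\<^sub>R y" "D = span {V y}"
        using null_dir by blast
      \<comment> \<open>Two null eigenvectors on different lines would make \<open>A\<close>
        diagonable.\<close>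
      have "y \<in> span {x}" "x \<in> span {y}" using two_null * x x0 y by blast+
      then have "V y \<in> span {V x}" "V x \<in> span {V y}" by (simp_all add: V_span)
      then show "D = span {V x}" unfolding y(4)
        by (intro subset_antisym span_minimal) auto
    qed
  next
    assume ex1: "\<exists>!D. null_eigendirection e g A D"
    then obtain D where "null_eigendirection e g A D" by blast
    then obtain x r where x: "x \<noteq> 0" "h x x = 0" "A *v x = r *\<^sub>R x"
      unfolding null_dir by blast
    \<comment> \<open>A diagonable \<open>A\<close> has a timelike eigenvector, and reflecting
      \<open>x\<close> in its orthogonal hyperplane produces a second null eigendirection.\<close>
    have "\<not> diagonable_real A"
    proof
      assume "diagonable_real A"
      then obtain w s where "h w w < 0" "A *v w = s *\<^sub>R w" using diag by blast
      then obtain y where y: "y \<noteq> 0" "h y y = 0" "A *v y = r *\<^sub>R y" "y \<notin> span {x}"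
        using reflected_null x by metis
      have "null_eigendirection e g A (span {V x})" "null_eigendirection e g A (span {V y})"
        unfolding null_dir using x y by blast+
      then have "span {V x} = span {V y}" using ex1 by blast
      then have "V y \<in> span {V x}" by (simp add: span_base)
      with y(4) show False by (simp add: V_span)
    qed
    moreover have "\<forall>l. eigenvalue A l \<longrightarrow> l \<in> \<real>"
      unfolding real_spectrum using null_eigenvector_no_pair[OF x] by blast
    ultimately show "(\<forall>l. eigenvalue A l \<longrightarrow> l \<in> \<real>) \<and> \<not> diagonable_real A" by blast
  qed

  have part4: "\<forall>k n l m. null g k \<and> null g n \<and> k \<noteq> n \<and> independent {k, n}
      \<and> tangent_eigenvector e A l k \<and> tangent_eigenvector e A m n
      \<longrightarrow> diagonable_real A \<and> l \<in> \<real> \<and> m \<in> \<real>"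
  proof (intro allI impI, elim conjE)
    fix k n l m
    assume kn: "null g k" "null g n" "k \<noteq> n" "independent {k, n}"
      "tangent_eigenvector e A l k" "tangent_eigenvector e A m n"
    obtain x where x: "k = V x" using V_surj by blast
    obtain y where y: "n = V y" using V_surj by blast
    have "n \<notin> span {k}"
      using kn(3,4) by (metis independent_insert insert_commute insert_iff singletonD)
    then have yx: "y \<notin> span {x}" by (simp add: x y V_span)
    have "x \<noteq> 0" "h x x = 0" "A *v x = Re l *\<^sub>R x" "l \<in> \<real>"
      using kn(1,5) by (auto simp: x null_V tan)
    moreover have "y \<noteq> 0" "h y y = 0" "A *v y = Re m *\<^sub>R y" "m \<in> \<real>"
      using kn(2,6) by (auto simp: y null_V tan)
    ultimately show "diagonable_real A \<and> l \<in> \<real> \<and> m \<in> \<real>"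
      using two_null yx by blast
  qed
  show ?thesis by (intro conjI part1 part2 part3 part4)
qed

end
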